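(* (1) For every integer $d \ge 2$ there exists a matrix $A: X \times Y \rightarrow [0,1]$ such that $\mathrm{Pdim}(A) = d$ and, for all integers $k \ge 1$, $P^*_{1/(2k)}(A) = k \cdot 2^d$. (2) There exists a matrix $A: X \times Y \rightarrow [0,1]$ such that $\mathrm{Pdim}(A) = 1$ and, for all integers $k \ge 2$, $P^*_{1/(2k)}(A) = k+2$.
   Context: A matrix is a function $A: X \times Y \rightarrow Z$ with $Z \subseteq \mathbb{R}$ (rows indexed by $X$, columns by $Y$). A set $J \subseteq Y$ is P-shattered by $A$ if there is $\vec t: J \rightarrow \mathbb{R}$ such that for every $b: J \rightarrow \{0,1\}$ there is $x \in X$ with, for all $y \in J$, $A(x,y) \ge \vec t(y)$ iff $b(y)=1$. For $\gamma > 0$, $J$ is $P_\gamma$-shattered by $A$ if there is $\vec t: J \rightarrow \mathbb{R}$ such that for every $b: J \rightarrow \{0,1\}$ there is $x \in X$ with, for all $y \in J$, $A(x,y) \ge \vec t(y)+\gamma$ if $b(y)=1$ and $A(x,y) < \vec t(y)-\gamma$ if $b(y)=0$. $\mathrm{Pdim}(A)$ (resp. $P_\gamma(A)$) is the largest size of a P-shattered (resp. $P_\gamma$-shattered) set $J \subseteq Y$, or $\infty$ if such sets of unbounded size exist. The transpose $A^\top: Y \times X \rightarrow Z$ is $A^\top(y,x) = A(x,y)$, and the dual fat-shattering dimension is $P^*_\gamma(A) := P_\gamma(A^\top)$.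
   Formalization: In the definition of P_γ-shattered the condition for b(y)=0 is A(x,y) ≤ t(y)−γ instead of the strict A(x,y) < t(y)−γ; with the strict inequality both parts are false (e.g. P*_{1/2}(A)=0 for every A with entries in [0,1]). *)

theory Defs
  imports Complex_Main "HOL-Library.Extended_Nat"
begin

text \<open>
  A matrix with rows X, columns Y and entries in Z is a function A of two arguments, of which
  only the values on X and Y matter.
\<close>

definition is_matrix :: "'a set \<Rightarrow> 'b set \<Rightarrow> real set \<Rightarrow> ('a \<Rightarrow> 'b \<Rightarrow> real) \<Rightarrow> bool" where
  "is_matrix X Y Z A \<longleftrightarrow> (\<forall>x\<in>X. \<forall>y\<in>Y. A x y \<in> Z)"

definition mat_transpose :: "('a \<Rightarrow> 'b \<Rightarrow> real) \<Rightarrow> 'b \<Rightarrow> 'a \<Rightarrow> real" where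
  "mat_transpose A = (\<lambda>y x. A x y)"

definition P_shattered :: "'a set \<Rightarrow> ('a \<Rightarrow> 'b \<Rightarrow> real) \<Rightarrow> 'b set \<Rightarrow> bool" where
  "P_shattered X A J \<longleftrightarrow>
     (\<exists>t :: 'b \<Rightarrow> real. \<forall>b :: 'b \<Rightarrow> bool. \<exists>x\<in>X. \<forall>y\<in>J. A x y \<ge> t y \<longleftrightarrow> b y)"

text \<open>
  Both margins are non-strict, as is standard for the fat-shattering dimension. If the lower one
  were strict, that is A x y < t y - gamma, then no nonempty set would be shattered with
  gamma = 1/2 by a matrix with entries in the unit interval, since a gap strictly larger
  than 1 would be needed.
\<close>

definition fat_shattered :: "real \<Rightarrow> 'a set \<Rightarrow> ('a \<Rightarrow> 'b \<Rightarrow> real) \<Rightarrow> 'b set \<Rightarrow> bool" where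
  "fat_shattered \<gamma> X A J \<longleftrightarrow>
     (\<exists>t :: 'b \<Rightarrow> real. \<forall>b :: 'b \<Rightarrow> bool. \<exists>x\<in>X. \<forall>y\<in>J.
        (b y \<longrightarrow> A x y \<ge> t y + \<gamma>) \<and> (\<not> b y \<longrightarrow> A x y \<le> t y - \<gamma>))"

text \<open>
  The supremum in the extended naturals is the largest cardinality if there is one and infinity
  if the cardinalities are unbounded. Restricting to finite J loses nothing, because
  shattering is inherited by subsets.
\<close>

definition Pdim :: "'a set \<Rightarrow> 'b set \<Rightarrow> ('a \<Rightarrow> 'b \<Rightarrow> real) \<Rightarrow> enat" where
  "Pdim X Y A = Sup {enat (card J) |J. J \<subseteq> Y \<and> finite J \<and> P_shattered X A J}"

definition fat_dim :: "real \<Rightarrow> 'a set \<Rightarrow> 'b set \<Rightarrow> ('a \<Rightarrow> 'b \<Rightarrow> real) \<Rightarrow> enat" where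
  "fat_dim \<gamma> X Y A = Sup {enat (card J) |J. J \<subseteq> Y \<and> finite J \<and> fat_shattered \<gamma> X A J}"

definition dual_fat_dim :: "real \<Rightarrow> 'a set \<Rightarrow> 'b set \<Rightarrow> ('a \<Rightarrow> 'b \<Rightarrow> real) \<Rightarrow> enat" where
  "dual_fat_dim \<gamma> X Y A = fat_dim \<gamma> Y X (mat_transpose A)"

end

theory Submission
  imports Defs "HOL-Library.Nat_Bijection"
begin

text \<open>
  The rows are split into blocks, and block \<open>k\<close> is split into layers \<open>1, \<dots>, k\<close>. Every column
  belongs to a block \<open>k\<close>. On a row of its own block in layer \<open>i\<close> it takes one of the values
  \<open>(i - 1) / k\<close> and \<open>i / k\<close>, all combinations being realised, and on the rows of all other blocks it
  takes the value \<open>1 / k\<close>. Block \<open>k\<close> is thus dually shattered with margin \<open>1 / (2 k)\<close>.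

  Columns that are P-shattered together belong to the same block and their thresholds cut through
  the same layer, so all non-constant patterns come from that layer. Layers of size \<open>2 ^ d\<close> therefore
  give pseudo-dimension \<open>d\<close> if \<open>d \<ge> 2\<close>. For \<open>d = 1\<close> all layers have size one except for the bottom and
  the top one, which may have size two since outside of them one of the two constant patterns is missing.

  Conversely, two rows of the same block \<open>a\<close> can only be separated against the order of
  their thresholds by columns of block \<open>a\<close>. Hence any third row of a dually shattered set has to
  vary by \<open>1 / k\<close> along these columns, which puts it into block \<open>a\<close> and forces \<open>a \<le> k\<close>.
\<close>

section \<open>Dimensions from a witness and an upper bound\<close>

lemma Pdim_eqI:
  assumes "J \<subseteq> Y" "finite J" "P_shattered X A J" "card J = n"
    and "\<And>J. J \<subseteq> Y \<Longrightarrow> finite J \<Longrightarrow> P_shattered X A J \<Longrightarrow> card J \<le> n"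
  shows "Pdim X Y A = enat n"
  unfolding Pdim_def
proof (rule antisym)
  show "enat n \<le> Sup {enat (card J) |J. J \<subseteq> Y \<and> finite J \<and> P_shattered X A J}"
    using assms(1-4) by (intro Sup_upper) blast
qed (use assms(5) in \<open>auto intro!: Sup_least\<close>)

lemma dual_fat_dim_eqI:
  assumes "J \<subseteq> X" "finite J" "fat_shattered \<gamma> Y (mat_transpose A) J" "card J = n"
    and "\<And>J. J \<subseteq> X \<Longrightarrow> finite J \<Longrightarrow> fat_shattered \<gamma> Y (mat_transpose A) J \<Longrightarrow> card J \<le> n"
  shows "dual_fat_dim \<gamma> X Y A = enat n"
  unfolding dual_fat_dim_def fat_dim_def
proof (rule antisym)
  show "enat n \<le> Sup {enat (card J) |J. J \<subseteq> X \<and> finite J \<and> fat_shattered \<gamma> Y (mat_transpose A) J}"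
    using assms(1-4) by (intro Sup_upper) blast
qed (use assms(5) in \<open>auto intro!: Sup_least\<close>)

section \<open>Matrices made of blocks and layers\<close>

locale layered_matrix =
  fixes X :: "'a set" and Y :: "'b set"
    and blk lay :: "'a \<Rightarrow> nat" and col :: "'b \<Rightarrow> nat" and up :: "'a \<Rightarrow> 'b \<Rightarrow> bool"
  assumes lay_pos: "x \<in> X \<Longrightarrow> 1 \<le> lay x"
    and lay_le_blk: "x \<in> X \<Longrightarrow> lay x \<le> blk x"
    and col_pos: "y \<in> Y \<Longrightarrow> 0 < col y"
    and finite_block: "finite {x \<in> X. blk x = k}"
    and ex_column: "k \<in> blk ` X \<Longrightarrow> T \<subseteq> {x \<in> X. blk x = k} \<Longrightarrow>
      \<exists>y\<in>Y. col y = k \<and> (\<forall>x\<in>X. blk x = k \<longrightarrow> up x y \<longleftrightarrow> x \<in> T)"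
begin

text \<open>The off-block value is 1 rather than 0 to make both extreme layers one-sided: for
  \<open>k \<ge> 2\<close>, a cut through layer 1 of block \<open>k\<close> is reached by all rows
  outside this layer, a cut through layer \<open>k\<close> by no row outside it.\<close>

definition level :: "'a \<Rightarrow> 'b \<Rightarrow> nat" where
  "level x y = (if blk x = col y then (if up x y then lay x else lay x - 1) else 1)"

definition entry :: "'a \<Rightarrow> 'b \<Rightarrow> real" where
  "entry x y = real (level x y) / real (col y)"

definition block :: "nat \<Rightarrow> 'a set" where
  "block k = {x \<in> X. blk x = k}"

definition layer :: "nat \<Rightarrow> nat \<Rightarrow> 'a set" where
  "layer k i = {x \<in> X. blk x = k \<and> lay x = i}"

lemma finite_layer: "finite (layer k i)"
  using finite_block[of k] unfolding layer_def by (rule rev_finite_subset) auto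

lemma is_matrix_entry: "is_matrix X Y {0..1} entry"
  unfolding is_matrix_def entry_def level_def
  using lay_le_blk col_pos by (fastforce simp: divide_le_eq_1)

text \<open>Entries of a column are integer multiples of \<open>1 / col y\<close>, so a real
  threshold acts only through its rounded-up multiple.\<close>

lemma entry_ge_iff:
  assumes "y \<in> Y"
  shows "t \<le> entry x y \<longleftrightarrow> \<lceil>t * real (col y)\<rceil> \<le> int (level x y)"
  using col_pos[OF assms] by (simp add: entry_def pos_le_divide_eq ceiling_le_iff)

section \<open>Dual fat-shattering\<close>

lemma fat_shattered_block:
  assumes "k \<in> blk ` X"
  shows "fat_shattered (1 / (2 * real k)) Y (mat_transpose entry) (block k)"
  unfolding fat_shattered_def
proof (intro exI allI)
  fix b :: "'a \<Rightarrow> bool"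
  obtain y where y: "y \<in> Y" "col y = k" "\<And>x. x \<in> block k \<Longrightarrow> up x y \<longleftrightarrow> b x"
    using ex_column[OF assms, of "{x \<in> block k. b x}"] unfolding block_def by blast
  have "k > 0" using col_pos y by blast
  \<comment> \<open>The threshold is the midpoint of the two values that a row takes on columns of
    its block; the margin is exactly half their distance.\<close>
  have "(b x \<longrightarrow> mat_transpose entry y x \<ge> (real (lay x) - 1/2) / real k + 1 / (2 * real k)) \<and>
        (\<not> b x \<longrightarrow> mat_transpose entry y x \<le> (real (lay x) - 1/2) / real k - 1 / (2 * real k))"
    if "x \<in> block k" for x
    using that y lay_pos[of x] \<open>k > 0\<close>
    by (auto simp: mat_transpose_def entry_def level_def block_def field_simps of_nat_diff)
  then show "\<exists>y\<in>Y. \<forall>x\<in>block k.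
      (b x \<longrightarrow> mat_transpose entry y x \<ge> (real (lay x) - 1/2) / real k + 1 / (2 * real k)) \<and>
      (\<not> b x \<longrightarrow> mat_transpose entry y x \<le> (real (lay x) - 1/2) / real k - 1 / (2 * real k))"
    using y(1) by blast
qed

text \<open>Four rows supply two disjoint pairs, which forces some two rows into a common block.
  Every further row is then drawn into it and bounds its index.\<close>

lemma fat_shattered_imp_block:
  assumes "J \<subseteq> X" "4 \<le> card J" "k \<ge> 1"
    and "fat_shattered (1 / (2 * real k)) Y (mat_transpose entry) J"
  shows "\<exists>a\<le>k. J \<subseteq> block a"
proof -
  obtain t where t: "\<And>b. \<exists>y\<in>Y. \<forall>x\<in>J.
      (b x \<longrightarrow> entry x y \<ge> t x + 1 / (2 * real k)) \<and> (\<not> b x \<longrightarrow> entry x y \<le> t x - 1 / (2 * real k))"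
    using assms(4) unfolding fat_shattered_def mat_transpose_def by blast
  have k: "1 / (2 * real k) > 0" using assms(3) by simp
  have separate: "blk p = col y \<or> blk q = col y"
    \<comment> \<open>Rows outside the block of a column share one value there, so it cannot
      separate them against the order of their thresholds.\<close>
    if "t p \<le> t q" "entry p y \<le> t p - 1 / (2 * real k)" "entry q y \<ge> t q + 1 / (2 * real k)" for p q y
  proof (rule ccontr)
    assume "\<not> ?thesis"
    then have "entry p y = entry q y" by (simp add: entry_def level_def)
    with that k show False by linarith
  qed
  \<comment> \<open>Two columns that separate \<open>p\<close> from \<open>q\<close> against the
    order lie in their block but make opposite demands on \<open>r\<close>. So \<open>r\<close>
    varies there by twice the margin, \<open>1 / k\<close>, whereas a row varies by at most
    \<open>1 / blk p\<close> if it is in this block and not at all otherwise.\<close>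
  have third: "blk r = blk p \<and> blk p \<le> k"
    if pqr: "p \<in> J" "q \<in> J" "r \<in> J" "p \<noteq> r" "q \<noteq> r" "p \<noteq> q" "blk p = blk q" "t p \<le> t q" for p q r
  proof -
    obtain y where y: "y \<in> Y" "entry p y \<le> t p - 1 / (2 * real k)"
      "entry q y \<ge> t q + 1 / (2 * real k)" "entry r y \<ge> t r + 1 / (2 * real k)"
      using t[of "\<lambda>x. x \<noteq> p"] pqr by metis
    obtain z where z: "z \<in> Y" "entry p z \<le> t p - 1 / (2 * real k)"
      "entry q z \<ge> t q + 1 / (2 * real k)" "entry r z \<le> t r - 1 / (2 * real k)"
      using t[of "\<lambda>x. x = q"] pqr by metis
    have c: "col y = blk p" "col z = blk p"
      using separate[of p q] y z pqr by metis+
    have pos: "blk p > 0" using col_pos[OF y(1)] c by simp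
    have "1 / real k \<le> entry r y - entry r z" using y z by (simp add: field_simps)
    also have "\<dots> = (real (level r y) - real (level r z)) / real (blk p)"
      by (simp add: entry_def c diff_divide_distrib)
    finally have gap: "1 / real k \<le> (real (level r y) - real (level r z)) / real (blk p)" .
    have 1: "blk r = blk p"
    proof (rule ccontr)
      assume "blk r \<noteq> blk p"
      then have "level r y = level r z" using c by (simp add: level_def)
      with gap assms(3) show False by simp
    qed
    have "real (level r y) - real (level r z) \<le> 1"
      by (cases "lay r") (simp_all add: level_def c 1)
    then have "(real (level r y) - real (level r z)) / real (blk p) \<le> 1 / real (blk p)"
      by (intro divide_right_mono) auto
    with gap have "1 / real k \<le> 1 / real (blk p)" by linarith
    then have "blk p \<le> k" using pos assms(3) by (simp add: field_simps)
    with 1 show ?thesis by blast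
  qed
  \<comment> \<open>If all blocks were distinct, a column separating two disjoint pairs against
    their orders would share its block with a row of each pair.\<close>
  have not_inj: "\<not> inj_on blk J"
  proof
    assume inj: "inj_on blk J"
    obtain K where "K \<subseteq> J" "card K = 4" using assms(2) by (metis obtain_subset_with_card_n)
    then have "finite K" by (metis card.infinite zero_neq_numeral)
    then obtain xs where "set xs = K" "distinct xs" using finite_distinct_list by blast
    moreover from this have "length xs = 4" using \<open>card K = 4\<close> distinct_card by fastforce
    then obtain p q r s where "xs = [p, q, r, s]"
      by (auto simp: numeral_eq_Suc length_Suc_conv)
    ultimately have d: "p \<in> J" "q \<in> J" "r \<in> J" "s \<in> J" "distinct [p, q, r, s]"
      using \<open>K \<subseteq> J\<close> by auto
    have order: "\<exists>u v. {u, v} = {x, y} \<and> t u \<le> t v" for x y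
    proof (cases "t x \<le> t y")
      case True
      then show ?thesis by (intro exI[of _ x] exI[of _ y]) simp
    next
      case False
      then show ?thesis by (intro exI[of _ y] exI[of _ x]) (simp add: insert_commute)
    qed
    obtain p' q' where pq: "{p', q'} = {p, q}" "t p' \<le> t q'" using order by blast
    obtain r' s' where rs: "{r', s'} = {r, s}" "t r' \<le> t s'" using order by blast
    have d': "p' \<in> J" "q' \<in> J" "r' \<in> J" "s' \<in> J" "distinct [p', q', r', s']"
      using d pq(1) rs(1) by (auto simp: doubleton_eq_iff)
    obtain y where y: "\<And>x. x \<in> J \<Longrightarrow> x = q' \<or> x = s' \<Longrightarrow> entry x y \<ge> t x + 1 / (2 * real k)"
      "\<And>x. x \<in> J \<Longrightarrow> \<not> (x = q' \<or> x = s') \<Longrightarrow> entry x y \<le> t x - 1 / (2 * real k)"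
      using t[of "\<lambda>x. x = q' \<or> x = s'"] by metis
    have "blk p' = col y \<or> blk q' = col y" "blk r' = col y \<or> blk s' = col y"
      using separate[of p' q' y] separate[of r' s' y] y d' pq(2) rs(2) by auto
    moreover have "blk p' \<noteq> blk r'" "blk p' \<noteq> blk s'" "blk q' \<noteq> blk r'" "blk q' \<noteq> blk s'"
      using d' by (auto simp: inj_on_eq_iff[OF inj])
    ultimately show False by auto
  qed
  then obtain p q where pq: "p \<in> J" "q \<in> J" "p \<noteq> q" "blk p = blk q" "t p \<le> t q"
    unfolding inj_on_def by (metis linear)
  have in_block: "blk r = blk p \<and> blk p \<le> k" if "r \<in> J - {p, q}" for r
    using third[of p q r] pq that by auto
  \<comment> \<open>The bound on \<open>blk p\<close> needs an actual third row.\<close>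
  have "card {p, q} < card J" using assms(2) pq(3) by simp
  then have "J - {p, q} \<noteq> {}"
    by (metis Diff_eq_empty_iff card_mono finite.emptyI finite.insertI not_le)
  then have "blk p \<le> k" using in_block by blast
  moreover have "J \<subseteq> block (blk p)" using in_block pq assms(1) unfolding block_def by auto
  ultimately show ?thesis by blast
qed

text \<open>Sets of at most three rows escape the structural result; the lower bound 3 on the block
  size covers them.\<close>

lemma dual_fat_dim_entry:
  assumes "k \<in> blk ` X" "3 \<le> card (block k)"
    and "\<And>a. a \<le> k \<Longrightarrow> card (block a) \<le> card (block k)"
  shows "dual_fat_dim (1 / (2 * real k)) X Y entry = enat (card (block k))"
proof (rule dual_fat_dim_eqI)
  show "block k \<subseteq> X" "finite (block k)" using finite_block by (auto simp: block_def)
  show "fat_shattered (1 / (2 * real k)) Y (mat_transpose entry) (block k)"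
    using assms(1) by (rule fat_shattered_block)
next
  fix J assume J: "J \<subseteq> X" "fat_shattered (1 / (2 * real k)) Y (mat_transpose entry) J"
  have "k \<ge> 1" using assms(1) lay_pos lay_le_blk by fastforce
  show "card J \<le> card (block k)"
  proof (cases "4 \<le> card J")
    case True
    with J \<open>k \<ge> 1\<close> obtain a where a: "a \<le> k" "J \<subseteq> block a"
      using fat_shattered_imp_block by blast
    then have "card J \<le> card (block a)"
      using finite_block[of a] by (intro card_mono) (auto simp: block_def)
    with a(1) assms(3) show ?thesis by (meson le_trans)
  qed (use assms(2) in simp)
qed simp

section \<open>Pseudo-dimension\<close>

lemma ex_P_shattered:
  assumes "2 ^ d \<le> card (layer k i)"
  shows "\<exists>J\<subseteq>Y. finite J \<and> card J = d \<and> P_shattered X entry J"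
proof -
  have "card (Pow {..<d}) \<le> card (layer k i)" using assms by (simp add: card_Pow)
  then obtain \<phi> where phi: "\<phi> ` Pow {..<d} \<subseteq> layer k i" "inj_on \<phi> (Pow {..<d})"
    using card_le_inj[of "Pow {..<d}" "layer k i"] finite_layer by auto
  have "\<phi> {} \<in> layer k i" using phi(1) by blast
  then have k: "k \<in> blk ` X" unfolding layer_def by auto
  \<comment> \<open>Row \<open>\<phi> S\<close> stands for the subset \<open>S\<close>; column
    \<open>j\<close> is raised on exactly those rows of the layer whose subset contains
    \<open>j\<close>.\<close>
  have "\<exists>y. y \<in> Y \<and> col y = k \<and> (\<forall>x\<in>layer k i. up x y \<longleftrightarrow> x \<in> \<phi> ` {S. S \<subseteq> {..<d} \<and> j \<in> S})" for j
  proof -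
    have "\<phi> ` {S. S \<subseteq> {..<d} \<and> j \<in> S} \<subseteq> {x \<in> X. blk x = k}"
      using phi(1) unfolding layer_def by blast
    from ex_column[OF k this] show ?thesis unfolding layer_def by (elim bexE) auto
  qed
  then obtain y where y: "\<And>j. y j \<in> Y" "\<And>j. col (y j) = k"
    "\<And>j x. x \<in> layer k i \<Longrightarrow> up x (y j) \<longleftrightarrow> x \<in> \<phi> ` {S. S \<subseteq> {..<d} \<and> j \<in> S}" by metis
  have up_iff: "up (\<phi> S) (y j) \<longleftrightarrow> j \<in> S" if "S \<subseteq> {..<d}" for S j
  proof -
    have "\<phi> S \<in> \<phi> ` {S. S \<subseteq> {..<d} \<and> j \<in> S} \<longleftrightarrow> S \<in> {S. S \<subseteq> {..<d} \<and> j \<in> S}"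
      by (rule inj_on_image_mem_iff[OF phi(2)]) (use that in auto)
    with y(3)[of "\<phi> S" j] phi(1) that show ?thesis by auto
  qed
  have inj: "inj_on y {..<d}"
  proof (rule inj_onI)
    fix j l assume jl: "j \<in> {..<d}" "l \<in> {..<d}" "y j = y l"
    have "up (\<phi> {j}) (y j)" using up_iff[of "{j}" j] jl(1) by simp
    then have "l \<in> {j}" unfolding jl(3) using up_iff[of "{j}" l] jl(1) by simp
    then show "j = l" by simp
  qed
  have "k > 0" using col_pos y(1) y(2) by metis
  have "P_shattered X entry (y ` {..<d})"
    unfolding P_shattered_def
  proof (intro exI allI)
    fix b :: "'b \<Rightarrow> bool"
    define S where "S = {j \<in> {..<d}. b (y j)}"
    have S: "S \<subseteq> {..<d}" unfolding S_def by auto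
    then have l: "\<phi> S \<in> layer k i" using phi(1) by blast
    then have x: "\<phi> S \<in> X" "blk (\<phi> S) = k" "lay (\<phi> S) = i" unfolding layer_def by auto
    have "real i / real k \<le> entry (\<phi> S) (y j) \<longleftrightarrow> b (y j)" if "j < d" for j
      using up_iff[OF S, of j] that x lay_pos[OF x(1)] \<open>k > 0\<close> y(2)[of j]
      by (auto simp: entry_def level_def S_def divide_le_cancel)
    with x(1) show "\<exists>x\<in>X. \<forall>z\<in>y ` {..<d}. real i / real k \<le> entry x z \<longleftrightarrow> b z"
      by auto
  qed
  then show ?thesis using y(1) inj
    by (intro exI[of _ "y ` {..<d}"]) (auto simp: card_image)
qed

text \<open>Only the two constant patterns can come from outside the layer that the thresholds cut,
  and only one of them if this layer is the bottom or top one of a block with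
  \<open>k \<ge> 2\<close>.\<close>

lemma P_shattered_bound:
  assumes J: "J \<subseteq> Y" "finite J" "2 \<le> card J" and sh: "P_shattered X entry J"
  shows "\<exists>k\<in>col ` Y. \<exists>i. 2 ^ card J \<le> card (layer k i) + 2 \<and>
    (2 \<le> k \<and> (i = 1 \<or> i = k) \<longrightarrow> 2 ^ card J \<le> card (layer k i) + 1)"
proof -
  obtain t where t: "\<And>b. \<exists>x\<in>X. \<forall>y\<in>J. entry x y \<ge> t y \<longleftrightarrow> b y"
    using sh unfolding P_shattered_def by blast
  define c where "c y = \<lceil>t y * real (col y)\<rceil>" for y
  have c: "\<exists>x\<in>X. \<forall>y\<in>J. c y \<le> int (level x y) \<longleftrightarrow> b y" for b
    using t[of b] J(1) entry_ge_iff unfolding c_def by (metis subsetD)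
  \<comment> \<open>The demanded pattern contradicts the comparison with level 1 at every column of
    \<open>J\<close>, yet each row has level 1 on one of two columns from different blocks.\<close>
  have same_col: "col y = col z" if "y \<in> J" "z \<in> J" for y z
  proof (rule ccontr)
    assume ne: "col y \<noteq> col z"
    obtain x where x: "x \<in> X" "\<And>w. w \<in> J \<Longrightarrow> c w \<le> int (level x w) \<longleftrightarrow> \<not> c w \<le> 1"
      using c[of "\<lambda>w. \<not> c w \<le> 1"] by blast
    have "level x y = 1 \<or> level x z = 1" using ne by (auto simp: level_def)
    then show False using x(2)[OF that(1)] x(2)[OF that(2)] by auto
  qed
  \<comment> \<open>If \<open>c y < c z\<close>, a row reaching the cut at \<open>z\<close> but not
    at \<open>y\<close> would have levels at least 2 apart, while levels of one row within a block
    differ by at most 1.\<close>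
  have c_le: "c z \<le> c y" if "y \<in> J" "z \<in> J" for y z
  proof (rule ccontr)
    assume less: "\<not> c z \<le> c y"
    obtain x where x: "x \<in> X" "\<And>w. w \<in> J \<Longrightarrow> c w \<le> int (level x w) \<longleftrightarrow> w = z"
      using c[of "\<lambda>w. w = z"] by blast
    have "y \<noteq> z" using less by auto
    then have "int (level x y) < c y" "c z \<le> int (level x z)" using x(2) that by force+
    then show False
      using less same_col[OF that] lay_pos[OF x(1)] by (auto simp: level_def split: if_splits)
  qed
  obtain y0 where y0: "y0 \<in> J" using J(3) by fastforce
  define k where "k = col y0"
  \<comment> \<open>A nonpositive cut gives \<open>i = 0\<close>, where the layer is empty because
    layers start at 1.\<close>
  define i where "i = nat (c y0)"
  have col: "col y = k" if "y \<in> J" for y using same_col[OF that y0] by (simp add: k_def)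
  have ceq: "c y = c y0" if "y \<in> J" for y using c_le[OF that y0] c_le[OF y0 that] by simp
  define pat where "pat x = {y \<in> J. c y0 \<le> int (level x y)}" for x
  have pat: "\<exists>x\<in>X. pat x = S" if S: "S \<subseteq> J" for S
  proof -
    obtain x where "x \<in> X" "\<And>y. y \<in> J \<Longrightarrow> c y \<le> int (level x y) \<longleftrightarrow> y \<in> S"
      using c[of "\<lambda>y. y \<in> S"] by blast
    with S ceq show ?thesis unfolding pat_def by (intro bexI[of _ x]) auto
  qed
  have other: "(pat x = J \<and> \<not> (2 \<le> k \<and> i = k)) \<or> (pat x = {} \<and> i \<noteq> 1)"
    if x: "x \<in> X" "x \<notin> layer k i" for x
  proof (cases "blk x = k")
    case True
    then have "int (lay x) \<noteq> c y0" using x by (auto simp: layer_def i_def)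
    then consider "int (lay x) < c y0" | "c y0 < int (lay x)" by linarith
    then show ?thesis
      using True lay_pos[OF x(1)] lay_le_blk[OF x(1)] col
      by cases (auto simp: pat_def level_def i_def)
  next
    case False
    then have "level x y = 1" if "y \<in> J" for y using col[OF that] by (simp add: level_def)
    then show ?thesis
      by (cases "c y0 \<le> 1") (auto simp: pat_def i_def)
  qed
  \<comment> \<open>\<open>Q\<close> collects the patterns available outside the layer; together
    with those from the layer they must exhaust all subsets of \<open>J\<close>.\<close>
  have count: "2 ^ card J \<le> card (layer k i) + card Q"
    if "\<And>x. x \<in> X \<Longrightarrow> x \<notin> layer k i \<Longrightarrow> pat x \<in> Q" "finite Q" for Q
  proof -
    have "Pow J \<subseteq> pat ` layer k i \<union> Q" using that(1) pat by blast
    then have "card (Pow J) \<le> card (pat ` layer k i \<union> Q)"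
      by (rule card_mono[rotated]) (simp add: that(2) finite_layer)
    also have "\<dots> \<le> card (pat ` layer k i) + card Q" by (rule card_Un_le)
    also have "\<dots> \<le> card (layer k i) + card Q" by (simp add: card_image_le finite_layer)
    finally show ?thesis by (simp add: card_Pow J(2))
  qed
  have "2 ^ card J \<le> card (layer k i) + card {{}, J}" using other by (intro count) auto
  moreover have "card {{}, J} \<le> 2" by (simp add: card_insert_if)
  moreover have "2 ^ card J \<le> card (layer k i) + 1" if "2 \<le> k" "i = 1 \<or> i = k"
    using that(2)
  proof
    assume "i = 1"
    then show ?thesis using other count[of "{J}"] by auto
  next
    assume "i = k"
    then show ?thesis using other that(1) count[of "{{}}"] by auto
  qed
  ultimately have "2 ^ card J \<le> card (layer k i) + 2 \<and>
    (2 \<le> k \<and> (i = 1 \<or> i = k) \<longrightarrow> 2 ^ card J \<le> card (layer k i) + 1)" by linarith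
  moreover have "k \<in> col ` Y" using y0 J(1) by (auto simp: k_def)
  ultimately show ?thesis by blast
qed

end

section \<open>Concrete blocks coded by natural numbers\<close>

text \<open>
  Row \<open>(k, i, v)\<close>, number \<open>v\<close> in layer \<open>i\<close> of block \<open>k\<close>, and column \<open>(k, S)\<close>, \<open>S\<close> a finite set of
  rows, are encoded as natural numbers.
\<close>

definition row_blk :: "nat \<Rightarrow> nat" where
  "row_blk x = fst (prod_decode x)"

definition row_lay :: "nat \<Rightarrow> nat" where
  "row_lay x = fst (prod_decode (snd (prod_decode x)))"

definition row_pos :: "nat \<Rightarrow> nat" where
  "row_pos x = snd (prod_decode (snd (prod_decode x)))"

definition row :: "nat \<Rightarrow> nat \<Rightarrow> nat \<Rightarrow> nat" where
  "row k i v = prod_encode (k, prod_encode (i, v))"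

definition rows :: "nat \<Rightarrow> (nat \<Rightarrow> nat \<Rightarrow> nat) \<Rightarrow> nat set" where
  "rows m g = {x. m \<le> row_blk x \<and> row_lay x \<in> {1..row_blk x} \<and> row_pos x < g (row_blk x) (row_lay x)}"

definition columns :: "nat \<Rightarrow> nat set" where
  "columns m = {y. m \<le> row_blk y}"

definition in_column :: "nat \<Rightarrow> nat \<Rightarrow> bool" where
  "in_column x y \<longleftrightarrow> x \<in> set_decode (snd (prod_decode y))"

lemma row_simps [simp]:
  "row_blk (row k i v) = k" "row_lay (row k i v) = i" "row_pos (row k i v) = v"
  by (simp_all add: row_def row_blk_def row_lay_def row_pos_def)

lemma row_decode [simp]: "row (row_blk x) (row_lay x) (row_pos x) = x"
  by (simp add: row_def row_blk_def row_lay_def row_pos_def)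

lemma row_eq_iff [simp]: "row k i v = row k' i' v' \<longleftrightarrow> k = k' \<and> i = i' \<and> v = v'"
  by (simp add: row_def)

lemma rows_block:
  "{x \<in> rows m g. row_blk x = k} =
    (if m \<le> k then (\<lambda>(i, v). row k i v) ` (SIGMA i:{1..k}. {..<g k i}) else {})"
  by (auto simp: rows_def intro!: image_eqI[where x = "(row_lay x, row_pos x)" for x])

lemma card_rows_block:
  "card {x \<in> rows m g. row_blk x = k} = (if m \<le> k then \<Sum>i = 1..k. g k i else 0)"
  unfolding rows_block by (auto simp: card_image inj_on_def)

lemma card_rows_layer:
  "card {x \<in> rows m g. row_blk x = k \<and> row_lay x = i} = (if m \<le> k \<and> i \<in> {1..k} then g k i else 0)"
proof -
  have "{x \<in> rows m g. row_blk x = k \<and> row_lay x = i} =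
      (if m \<le> k \<and> i \<in> {1..k} then row k i ` {..<g k i} else {})"
    by (auto simp: rows_def intro!: image_eqI[where x = "row_pos x" for x])
  then show ?thesis by (auto simp: card_image inj_on_def)
qed

text \<open>Blocks are finite, so each subset of a block has a code \<open>set_encode T\<close>. Row
  and column codes both start with the block, so \<open>row_blk\<close> serves both.\<close>

lemma layered_matrix_rows:
  assumes "1 \<le> m"
  shows "layered_matrix (rows m g) (columns m) row_blk row_lay row_blk in_column"
proof
  show "finite {x \<in> rows m g. row_blk x = k}" for k
    unfolding rows_block by simp
  then show "\<exists>y\<in>columns m. row_blk y = k \<and> (\<forall>x\<in>rows m g. row_blk x = k \<longrightarrow> in_column x y \<longleftrightarrow> x \<in> T)"
    if "k \<in> row_blk ` rows m g" "T \<subseteq> {x \<in> rows m g. row_blk x = k}" for k T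
    using that finite_subset[OF that(2)]
    by (intro bexI[of _ "prod_encode (k, set_encode T)"])
      (auto simp: in_column_def columns_def row_blk_def rows_def set_encode_inverse)
qed (use assms in \<open>auto simp: rows_def columns_def\<close>)

lemma row_blk_rows:
  assumes "m \<le> k" "1 \<le> k" "0 < g k 1"
  shows "k \<in> row_blk ` rows m g"
  using assms by (intro image_eqI[of _ _ "row k 1 0"]) (auto simp: rows_def)

section \<open>The two families of matrices\<close>

lemma ex_matrix_Pdim_ge_2:
  assumes "d \<ge> 2"
  shows "\<exists>(X :: nat set) (Y :: nat set) (A :: nat \<Rightarrow> nat \<Rightarrow> real).
    is_matrix X Y {0..1} A \<and> Pdim X Y A = enat d \<and>
    (\<forall>k::nat. k \<ge> 1 \<longrightarrow> dual_fat_dim (1 / (2 * real k)) X Y A = enat (k * 2 ^ d))"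
proof -
  define g where "g k i = (2::nat) ^ d" for k i :: nat
  interpret layered_matrix "rows 1 g" "columns 1" row_blk row_lay row_blk in_column
    by (rule layered_matrix_rows) simp
  \<comment> \<open>This makes \<open>2 ^ Suc d \<le> 2 ^ d + 2\<close> impossible; for
    \<open>d = 1\<close> equality would hold.\<close>
  have four: "(4::nat) \<le> 2 ^ d" using power_increasing[of 2 d "2::nat"] assms by simp
  have card_block: "card (block k) = k * 2 ^ d" for k
    unfolding block_def card_rows_block by (simp add: g_def)
  have card_layer: "card (layer k i) \<le> 2 ^ d" for k i
    unfolding layer_def card_rows_layer by (simp add: g_def)
  have "card (layer 1 1) = 2 ^ d"
    unfolding layer_def card_rows_layer by (simp add: g_def)
  then obtain J where J: "J \<subseteq> columns 1" "finite J" "P_shattered (rows 1 g) entry J" "card J = d"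
    using ex_P_shattered[of d 1 1] by auto
  have "Pdim (rows 1 g) (columns 1) entry = enat d"
  proof (rule Pdim_eqI[OF J])
    fix J assume J: "J \<subseteq> columns 1" "finite J" "P_shattered (rows 1 g) entry J"
    show "card J \<le> d"
    proof (rule ccontr)
      assume "\<not> card J \<le> d"
      then have "Suc d \<le> card J" by simp
      moreover from this J assms obtain k i where "1 \<le> k" "2 ^ card J \<le> card (layer k i) + 2"
        using P_shattered_bound[of J] by (auto simp: columns_def)
      ultimately have "(2::nat) ^ Suc d \<le> 2 ^ d + 2"
        using card_layer[of k i] power_increasing[of "Suc d" "card J" "2::nat"] by simp
      with four show False by simp
    qed
  qed
  moreover have "dual_fat_dim (1 / (2 * real k)) (rows 1 g) (columns 1) entry = enat (k * 2 ^ d)"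
    if "k \<ge> 1" for k
  proof -
    have "4 \<le> k * 2 ^ d" using mult_le_mono[OF that four] by simp
    then show ?thesis
      using that row_blk_rows[of 1 k g]
      by (intro dual_fat_dim_entry[of k, unfolded card_block]) (auto simp: g_def)
  qed
  ultimately show ?thesis using is_matrix_entry by blast
qed

text \<open>Blocks start at 2, so that bottom and top layers differ. With two rows in each of these
  and one in every other layer, block \<open>k\<close> has \<open>k + 2\<close> rows, and a layer
  plus its outside patterns yields at most 3 patterns, fewer than the 4 needed for two
  columns.\<close>

lemma ex_matrix_Pdim_1:
  "\<exists>(X :: nat set) (Y :: nat set) (A :: nat \<Rightarrow> nat \<Rightarrow> real).
    is_matrix X Y {0..1} A \<and> Pdim X Y A = enat 1 \<and>
    (\<forall>k::nat. k \<ge> 2 \<longrightarrow> dual_fat_dim (1 / (2 * real k)) X Y A = enat (k + 2))"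
proof -
  define g where "g k i = 1 + (if i = 1 then 1 else 0) + (if i = k then 1 else 0 :: nat)" for k i :: nat
  interpret layered_matrix "rows 2 g" "columns 2" row_blk row_lay row_blk in_column
    by (rule layered_matrix_rows) simp
  have card_block: "card (block k) = (if 2 \<le> k then k + 2 else 0)" for k
    unfolding block_def card_rows_block g_def sum.distrib by simp
  have card_layer: "card (layer k i) \<le> g k i" for k i
    unfolding layer_def card_rows_layer by simp
  have "card (layer 2 1) = 2 ^ 1"
    unfolding layer_def card_rows_layer by (simp add: g_def)
  then obtain J where J: "J \<subseteq> columns 2" "finite J" "P_shattered (rows 2 g) entry J" "card J = 1"
    using ex_P_shattered[of 1 2 1] by auto
  have "Pdim (rows 2 g) (columns 2) entry = enat 1"
  proof (rule Pdim_eqI[OF J])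
    fix J assume J: "J \<subseteq> columns 2" "finite J" "P_shattered (rows 2 g) entry J"
    show "card J \<le> 1"
    proof (rule ccontr)
      assume "\<not> card J \<le> 1"
      then have two: "2 \<le> card J" by simp
      from P_shattered_bound[OF J(1,2) two J(3)]
      obtain k i where "2 \<le> k" "2 ^ card J \<le> card (layer k i) + 2"
        "i = 1 \<or> i = k \<longrightarrow> 2 ^ card J \<le> card (layer k i) + 1"
        by (auto simp: columns_def)
      then show False
        using card_layer[of k i] power_increasing[OF two, of "2::nat"]
        by (auto simp: g_def split: if_splits)
    qed
  qed
  moreover have "dual_fat_dim (1 / (2 * real k)) (rows 2 g) (columns 2) entry = enat (k + 2)"
    if "k \<ge> 2" for k
    using dual_fat_dim_entry[of k] row_blk_rows[of 2 k g] that
    by (simp add: card_block) (simp add: g_def)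
  ultimately show ?thesis using is_matrix_entry by blast
qed

theorem theorem9:
  shows "(\<forall>d::nat. d \<ge> 2 \<longrightarrow>
            (\<exists>(X :: nat set) (Y :: nat set) (A :: nat \<Rightarrow> nat \<Rightarrow> real).
               is_matrix X Y {0..1} A \<and> Pdim X Y A = enat d \<and>
               (\<forall>k::nat. k \<ge> 1 \<longrightarrow>
                  dual_fat_dim (1 / (2 * real k)) X Y A = enat (k * 2 ^ d))))
       \<and> (\<exists>(X :: nat set) (Y :: nat set) (A :: nat \<Rightarrow> nat \<Rightarrow> real).
             is_matrix X Y {0..1} A \<and> Pdim X Y A = enat 1 \<and>
             (\<forall>k::nat. k \<ge> 2 \<longrightarrow>
                dual_fat_dim (1 / (2 * real k)) X Y A = enat (k + 2)))"
  using ex_matrix_Pdim_ge_2 ex_matrix_Pdim_1 by blast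

end
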